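(* Let $k\in\mathbb N$, $m_1,\dots,m_k\in\mathbb N$ and let $b_1,\dots,b_k$ be positive real numbers. For $z\in\mathbb C$ consider the nested integral $f(z)=I_{m_1,m_2,\ldots,m_k}(b_1,b_2,\ldots,b_k;z)$ defined in the context. Then $f(z)$ is of C-type.
   Context: $\mathbb N=\{1,2,\dots\}$. C-type: a function $f:M\to\mathbb C$ on a region $M\subset\mathbb C$ is of Carlson-type (C-type) if (i) it is analytic in the right half plane $\{\operatorname{Re}(z)\ge 0\}$; (ii) it is of exponential type there, i.e. there exist real $c,C>0$ with $|f(z)|\le C e^{c|z|}$ for all $z$ with $\operatorname{Re}(z)\ge0$; (iii) there exist real $c,C>0$ with $c<\pi$ such that $|f(iy)|\le Ce^{c|y|}$ for all $y\in\mathbb R$. Nested integral: put $B_0=1$ and $B_j=b_1b_2\cdots b_j$ for $1\le j\le k$, and let $F_0(x)=x^z-1$ for $x>0$. For $j=1,\dots,k$ define $$g_{j,1}(u)=\frac{F_{j-1}(u)}{u-B_{j-1}},\qquad g_{j,i}(u)=\frac1u\int_0^u g_{j,i-1}(t)\,dt\quad(2\le i\le m_j),$$ $$F_j(x)=\int_{B_j}^{x}g_{j,m_j}(u)\,du ,$$ and finally $$I_{m_1,\ldots,m_k}(b_1,\ldots,b_k;z)=\int_0^{b_1\cdots b_k}g_{k,m_k}(u)\,du.$$ (The singularities at $u=B_{j-1}$ are removable.) Example: $I_{2,1}(a,b;z)=\int_0^{ab}\frac{1}{x-a}\int_a^x\frac1y\int_0^y\frac{t^z-1}{t-1}\,dt\,dy\,dx$.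 *)

theory Defs
  imports "HOL-Complex_Analysis.Complex_Analysis"
begin

text \<open>
  Functions are total, so the region on which \<open>f\<close> lives is left implicit: \<open>analytic_on\<close> asks for
  holomorphy on an open neighbourhood of the closed half plane.
\<close>

definition carlson_type :: "(complex \<Rightarrow> complex) \<Rightarrow> bool" where
  "carlson_type f \<longleftrightarrow>
     f analytic_on {z. Re z \<ge> 0} \<and>
     (\<exists>c C :: real. c > 0 \<and> C > 0 \<and>
        (\<forall>z. Re z \<ge> 0 \<longrightarrow> norm (f z) \<le> C * exp (c * norm z))) \<and>
     (\<exists>c C :: real. c > 0 \<and> C > 0 \<and> c < pi \<and>
        (\<forall>y :: real. norm (f (\<i> * of_real y)) \<le> C * exp (c * \<bar>y\<bar>)))"

definition bprod :: "(nat \<Rightarrow> real) \<Rightarrow> nat \<Rightarrow> real" where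
  "bprod b j = (\<Prod>i=1..j. b i)"

definition average :: "(real \<Rightarrow> complex) \<Rightarrow> real \<Rightarrow> complex" where
  "average h u = 1 / of_real u * (LBINT t=0..u. h t)"

text \<open>
  \<open>nested_g F B i\<close> is \<open>g\<^sub>j\<^sub>,\<^sub>i\<close> (for \<open>i \<ge> 1\<close>) with \<open>F = F\<^sub>j\<^sub>-\<^sub>1\<close> and \<open>B = B\<^sub>j\<^sub>-\<^sub>1\<close>. At the removable
  singularity \<open>u = B\<close> the quotient has the value \<open>0\<close> by the convention \<open>x / 0 = 0\<close>; this is harmless,
  since these functions only ever occur under an integral.
\<close>

definition nested_g :: "(real \<Rightarrow> complex) \<Rightarrow> real \<Rightarrow> nat \<Rightarrow> real \<Rightarrow> complex" where
  "nested_g F B i = (average ^^ (i - 1)) (\<lambda>u. F u / of_real (u - B))"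

text \<open>
  The interval integral is oriented, as needed for \<open>x < B\<^sub>j\<close>.
\<close>

primrec nested_F :: "(nat \<Rightarrow> nat) \<Rightarrow> (nat \<Rightarrow> real) \<Rightarrow> complex \<Rightarrow> nat \<Rightarrow> real \<Rightarrow> complex" where
  "nested_F m b z 0 = (\<lambda>x. of_real x powr z - 1)"
| "nested_F m b z (Suc j) =
     (\<lambda>x. LBINT u=bprod b (Suc j)..x. nested_g (nested_F m b z j) (bprod b j) (m (Suc j)) u)"

text \<open>
  The parameters are indexed from 1: only \<open>m 1, \<dots>, m k\<close> and \<open>b 1, \<dots>, b k\<close> matter, and \<open>k \<ge> 1\<close>.
\<close>

definition nested_integral :: "nat \<Rightarrow> (nat \<Rightarrow> nat) \<Rightarrow> (nat \<Rightarrow> real) \<Rightarrow> complex \<Rightarrow> complex" where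
  "nested_integral k m b z =
     (LBINT u=0..bprod b k. nested_g (nested_F m b z (k - 1)) (bprod b (k - 1)) (m k) u)"

end

theory Submission
  imports Defs
begin

text \<open>
  Since \<open>F\<^sub>j\<close> vanishes at \<open>B\<^sub>j\<close>, the quotient \<open>F\<^sub>j(u) / (u - B\<^sub>j)\<close> is the mean value of \<open>g\<^sub>j\<close> over the
  segment from \<open>B\<^sub>j\<close> to \<open>u\<close>, and \<open>(1/u) \<integral>\<^sub>0\<^sup>u\<close> is the mean value over \<open>(0, u)\<close>. Thus the nested integral is
  \<open>B\<^sub>k\<close> times an iterated mean value of \<open>(u\<^sup>z - 1) / (u - 1)\<close> on a bounded interval \<open>(0, X]\<close>. Mean
  values do not increase a uniform bound, so for \<open>Re z \<ge> 0\<close> the bound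
  \<open>4 + 2 |z| X\<^bsup>|Re z|\<^esup>\<close> of the innermost function survives; on the imaginary axis it grows only
  linearly. For \<open>Re z > -1/2\<close> the weaker bound \<open>O(1 / \<surd>u)\<close> also survives, because the mean value
  of \<open>1 / \<surd>t\<close> between \<open>a\<close> and \<open>u\<close> is \<open>2 / (\<surd>a + \<surd>u) \<le> 2 / \<surd>u\<close>. It provides the integrable majorant
  that makes every mean value holomorphic on the open half plane \<open>Re z > -1/2\<close>.
\<close>

section \<open>Holomorphic dependence of an integral on a parameter\<close>

text \<open>Cauchy's inequality turns a local majorant of \<open>f\<close> into one for its
  \<open>z\<close>-derivative, hence for the difference quotients; dominated convergence then
  differentiates under the integral.\<close>

lemma holomorphic_on_lebesgue_integral:
  fixes f :: "complex \<Rightarrow> 'a \<Rightarrow> complex"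
  assumes "open S"
    and meas: "\<And>z. z \<in> S \<Longrightarrow> f z \<in> borel_measurable M"
    and holo: "\<And>x. x \<in> space M \<Longrightarrow> (\<lambda>z. f z x) holomorphic_on S"
    and bound: "\<And>z. z \<in> S \<Longrightarrow>
      \<exists>r>0. \<exists>w. integrable M w \<and> (\<forall>y\<in>ball z r. \<forall>x\<in>space M. norm (f y x) \<le> w x)"
  shows "(\<lambda>z. \<integral>x. f z x \<partial>M) holomorphic_on S"
proof -
  have "(\<lambda>z. \<integral>x. f z x \<partial>M) field_differentiable at z" if "z \<in> S" for z
  proof -
    obtain r0 w where "r0 > 0" and w: "integrable M w"
      and w_bound: "\<And>y x. y \<in> ball z r0 \<Longrightarrow> x \<in> space M \<Longrightarrow> norm (f y x) \<le> w x"
      using bound[OF \<open>z \<in> S\<close>] by blast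
    obtain r1 where "r1 > 0" "ball z r1 \<subseteq> S"
      using \<open>open S\<close> \<open>z \<in> S\<close> open_contains_ball by blast
    define r where "r = min r0 r1"
    have "r > 0" and r_S: "ball z r \<subseteq> S" and r_r0: "ball z r \<subseteq> ball z r0"
      using \<open>r0 > 0\<close> \<open>r1 > 0\<close> \<open>ball z r1 \<subseteq> S\<close> by (auto simp: r_def)
    \<comment> \<open>Discs of radius \<open>r / 4\<close> about points of \<open>U\<close> stay
      inside \<open>ball z r\<close>, where \<open>w\<close> dominates.\<close>
    define U where "U = ball z (r / 2)"
    have "open U" "convex U" "z \<in> U" and U_S: "U \<subseteq> S"
      using \<open>r > 0\<close> r_S by (auto simp: U_def)
    define q where "q y x = (f y x - f z x) / (y - z)" for y x
    define f' where "f' x = deriv (\<lambda>y. f y x) z" for x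
    have der: "((\<lambda>y. f y x) has_field_derivative deriv (\<lambda>y. f y x) y) (at y)"
      if "x \<in> space M" "y \<in> S" for x y
      using holomorphic_derivI[OF holo \<open>open S\<close>] that by blast
    have der_bound: "norm (deriv (\<lambda>y. f y x) y) \<le> w x / (r / 4)"
      if "x \<in> space M" "y \<in> U" for x y
    proof -
      have sub: "cball y (r / 4) \<subseteq> ball z r"
      proof
        fix v assume "v \<in> cball y (r / 4)"
        then show "v \<in> ball z r"
          using \<open>y \<in> U\<close> dist_triangle[of z v y] \<open>r > 0\<close> by (auto simp: U_def)
      qed
      have "norm ((deriv ^^ 1) (\<lambda>y. f y x) y) \<le> fact 1 * w x / (r / 4) ^ 1"
      proof (rule Cauchy_inequality)
        show "(\<lambda>y. f y x) holomorphic_on ball y (r / 4)"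
          using holo[OF \<open>x \<in> space M\<close>] sub r_S ball_subset_cball
          by (meson holomorphic_on_subset order_trans)
        show "continuous_on (cball y (r / 4)) (\<lambda>y. f y x)"
          using holo[OF \<open>x \<in> space M\<close>] sub r_S
          by (meson holomorphic_on_subset holomorphic_on_imp_continuous_on order_trans)
        show "norm (f v x) \<le> w x" if "norm (y - v) = r / 4" for v
          using that w_bound[OF _ \<open>x \<in> space M\<close>] sub r_r0 by (auto simp: dist_norm subset_iff)
      qed (use \<open>r > 0\<close> in auto)
      then show ?thesis by simp
    qed
    have q_bound: "norm (q y x) \<le> w x / (r / 4)" if "x \<in> space M" "y \<in> U - {z}" for x y
    proof -
      have "norm (f y x - f z x) \<le> w x / (r / 4) * norm (y - z)"
        by (rule field_differentiable_bound[OF \<open>convex U\<close>,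
              where f = "\<lambda>y. f y x" and f' = "deriv (\<lambda>y. f y x)"])
           (use that \<open>z \<in> U\<close> U_S der der_bound in
             \<open>auto intro: has_field_derivative_at_within simp: subset_iff\<close>)
      then show ?thesis
        using that by (simp add: q_def norm_divide field_simps)
    qed
    have q_lim: "((\<lambda>y. q y x) \<longlongrightarrow> f' x) (at z within U)" if "x \<in> space M" for x
      using has_field_derivative_at_within[OF der[OF that \<open>z \<in> S\<close>], of U]
      unfolding f'_def q_def has_field_derivative_iff .
    have q_meas: "q y \<in> borel_measurable M" if "y \<in> U" for y
      using meas[of y] meas[of z] that U_S \<open>z \<in> S\<close> unfolding q_def by auto
    \<comment> \<open>Dominated convergence concerns sequences, so the limit is tested along
      sequences in \<open>U - {z}\<close>.\<close>
    have "((\<lambda>y. \<integral>x. q y x \<partial>M) \<longlongrightarrow> (\<integral>x. f' x \<partial>M)) (at z within U)"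
      unfolding tendsto_at_iff_sequentially comp_def
    proof (intro allI impI)
      fix Y assume Y: "\<forall>i. Y i \<in> U - {z}" and "Y \<longlonglongrightarrow> z"
      have conv: "(\<lambda>i. q (Y i) x) \<longlonglongrightarrow> f' x" if "x \<in> space M" for x
        using q_lim[OF that] Y \<open>Y \<longlonglongrightarrow> z\<close>
        unfolding tendsto_at_iff_sequentially comp_def by blast
      show "(\<lambda>i. \<integral>x. q (Y i) x \<partial>M) \<longlonglongrightarrow> (\<integral>x. f' x \<partial>M)"
      proof (rule integral_dominated_convergence)
        show "f' \<in> borel_measurable M"
          by (rule borel_measurable_LIMSEQ_metric[where f = "\<lambda>i. q (Y i)"])
             (use Y q_meas conv in auto)
        show "integrable M (\<lambda>x. w x / (r / 4))"
          using w by simp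
      qed (use Y q_meas conv q_bound in auto)
    qed
    \<comment> \<open>Linearity needs both integrals to exist, which \<open>w\<close> ensures; at
      \<open>y = z\<close> both sides are 0.\<close>
    moreover have "(\<integral>x. q y x \<partial>M) = ((\<integral>x. f y x \<partial>M) - (\<integral>x. f z x \<partial>M)) / (y - z)"
      if "y \<in> U" for y
    proof -
      have "integrable M (f v)" if "v \<in> U" for v
        by (rule Bochner_Integration.integrable_bound[OF w])
           (use that U_S meas w_bound r_r0 \<open>r > 0\<close> in
             \<open>force simp: U_def intro!: AE_I2 intro: order_trans[OF _ abs_ge_self]\<close>)+
      then show ?thesis
        using that \<open>z \<in> U\<close> unfolding q_def by simp
    qed
    ultimately have "((\<lambda>z. \<integral>x. f z x \<partial>M) has_field_derivative (\<integral>x. f' x \<partial>M)) (at z within U)"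
      unfolding has_field_derivative_iff
      by (rule Lim_transform_within[OF _ zero_less_one])
         auto
    then show ?thesis
      using \<open>open U\<close> \<open>z \<in> U\<close> at_within_open unfolding field_differentiable_def by metis
  qed
  then show ?thesis
    using field_differentiable_at_within unfolding holomorphic_on_def by blast
qed

section \<open>Mean values over a segment and their bounds\<close>

text \<open>The signs of the oriented integral and of \<open>u - a\<close> cancel, so this is a mean
  on either side of \<open>a\<close>. At \<open>u = a\<close> it is 0, like the quotient in
  \<open>nested_g\<close> at its singularity.\<close>

definition interval_mean :: "real \<Rightarrow> (real \<Rightarrow> complex) \<Rightarrow> real \<Rightarrow> complex" where
  "interval_mean a h u = 1 / of_real (u - a) * (LBINT t=a..u. h t)"

text \<open>Writes the oriented integral as one integral over the line, with a weight jointly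
  measurable in \<open>u\<close> and \<open>t\<close>.\<close>

definition segment_sign :: "real \<Rightarrow> real \<Rightarrow> real \<Rightarrow> real" where
  "segment_sign a u t = indicator {a<..<u} t - indicator {u<..<a} t"

lemma LBINT_segment_sign:
  fixes h :: "real \<Rightarrow> complex"
  shows "(LBINT t=a..u. h t) = (\<integral>t. segment_sign a u t *\<^sub>R h t \<partial>lborel)"
  by (auto simp: interval_lebesgue_integral_def set_lebesgue_integral_def segment_sign_def
      einterval_eq Bochner_Integration.integral_minus[symmetric]
      simp del: Bochner_Integration.integral_minus intro!: Bochner_Integration.integral_cong)

lemma set_integral_inverse_sqrt:
  assumes "0 \<le> a" "a \<le> b"
  shows "set_integrable lborel {a<..<b} (\<lambda>t. 1 / sqrt t)"
    and "(LBINT t:{a<..<b}. 1 / sqrt t) = 2 * (sqrt b - sqrt a)"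
proof -
  have *: "set_integrable lborel {a<..<b} (\<lambda>t. 1 / sqrt t) \<and>
    (LBINT t:{a<..<b}. 1 / sqrt t) = 2 * (sqrt b - sqrt a)" if "a < b"
  proof -
    have tends: "(((\<lambda>x. 2 * sqrt x) \<circ> real_of_ereal) \<longlongrightarrow> 2 * sqrt c) (at (ereal c) within T)" for c T
      by (auto intro!: tendsto_eq_intros simp: comp_def)
    have prems: "ereal a < ereal b"
      "\<And>x. ereal a < ereal x \<Longrightarrow> ereal x < ereal b \<Longrightarrow>
        ((\<lambda>x. 2 * sqrt x) has_real_derivative 1 / sqrt x) (at x)"
      "\<And>x. ereal a < ereal x \<Longrightarrow> ereal x < ereal b \<Longrightarrow> isCont (\<lambda>t. 1 / sqrt t) x"
      "AE x in lborel. ereal a < ereal x \<longrightarrow> ereal x < ereal b \<longrightarrow> 0 \<le> 1 / sqrt x"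
      using that \<open>0 \<le> a\<close>
      by (auto intro!: derivative_eq_intros continuous_intros simp: field_simps)
    show ?thesis
      using interval_integral_FTC_nonneg[OF prems tends tends] that
      by (simp add: interval_lebesgue_integral_def)
  qed
  show "set_integrable lborel {a<..<b} (\<lambda>t. 1 / sqrt t)"
    "(LBINT t:{a<..<b}. 1 / sqrt t) = 2 * (sqrt b - sqrt a)"
    using * assms
    by (cases "a = b"; force simp: set_integrable_def set_lebesgue_integral_def)+
qed


lemma abs_segment_sign: "\<bar>segment_sign a u t\<bar> = indicator {min a u<..<max a u} t"
  by (auto simp: segment_sign_def indicator_def)

lemma interval_mean_altdef:
  "interval_mean a h u = 1 / of_real (u - a) * (\<integral>t. segment_sign a u t *\<^sub>R h t \<partial>lborel)"
  by (simp add: interval_mean_def LBINT_segment_sign)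

text \<open>A constant \<open>w\<close> preserves a uniform bound; \<open>w\<close> proportional to
  \<open>1 / sqrt t\<close> controls the singularity at 0.\<close>

lemma norm_interval_mean_le:
  assumes w: "set_integrable lborel {min a u<..<max a u} w"
    and bound: "\<And>t. min a u < t \<Longrightarrow> t < max a u \<Longrightarrow> norm (h t) \<le> w t"
    and "(LBINT t:{min a u<..<max a u}. w t) \<le> D * \<bar>u - a\<bar>" and "0 \<le> D"
  shows "norm (interval_mean a h u) \<le> D"
proof -
  let ?f = "\<lambda>t. segment_sign a u t *\<^sub>R h t"
  \<comment> \<open>A non-integrable integrand has integral 0 by convention, and the bound then
    follows from \<open>0 \<le> D\<close>.\<close>
  have "norm (\<integral>t. ?f t \<partial>lborel) \<le> D * \<bar>u - a\<bar>"
  proof (cases "integrable lborel ?f")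
    case True
    have "norm (\<integral>t. ?f t \<partial>lborel) \<le> (LBINT t:{min a u<..<max a u}. w t)"
      unfolding set_lebesgue_integral_def
    proof (rule Bochner_Integration.integral_norm_bound_integral[OF True])
      show "integrable lborel (\<lambda>t. indicat_real {min a u<..<max a u} t *\<^sub>R w t)"
        using w by (simp add: set_integrable_def)
      show "norm (?f t) \<le> indicat_real {min a u<..<max a u} t *\<^sub>R w t" for t
        using bound[of t] by (simp add: abs_segment_sign) (simp add: indicator_def)
    qed
    with assms show ?thesis by linarith
  qed (use \<open>0 \<le> D\<close> in \<open>simp add: not_integrable_integral_eq\<close>)
  then show ?thesis
    using \<open>0 \<le> D\<close> by (cases "u = a") (auto simp: interval_mean_altdef norm_divide field_simps
        simp flip: of_real_diff)
qed

section \<open>Admissible families and their stability under means\<close>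

text \<open>The invariant of the construction. The last bound gives the growth; the one with
  \<open>1 / sqrt u\<close> is integrable at 0 and carries holomorphy across the imaginary axis.
  \<open>K\<close> may grow with each mean, while \<open>N\<close> stays fixed.\<close>

definition admissible :: "(complex \<Rightarrow> real) \<Rightarrow> real \<Rightarrow> (complex \<Rightarrow> real \<Rightarrow> complex) \<Rightarrow> bool" where
  "admissible N X G \<longleftrightarrow>
     (\<forall>z. Re z > -1/2 \<longrightarrow> set_borel_measurable borel {0<..X} (G z)) \<and>
     (\<forall>u\<in>{0<..X}. (\<lambda>z. G z u) holomorphic_on {z. Re z > -1/2}) \<and>
     (\<exists>K\<ge>0. \<forall>z u. Re z > -1/2 \<longrightarrow> u \<in> {0<..X} \<longrightarrow> norm (G z u) \<le> K * N z / sqrt u) \<and>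
     (\<forall>z u. Re z \<ge> 0 \<longrightarrow> u \<in> {0<..X} \<longrightarrow> norm (G z u) \<le> N z)"

lemma set_borel_measurable_interval_mean:
  assumes "set_borel_measurable borel {0<..X} h" "0 \<le> a" "a \<le> X"
  shows "set_borel_measurable borel {0<..X} (interval_mean a h)"
proof -
  \<comment> \<open>\<open>h\<close> is known to be measurable only on \<open>{0<..X}\<close>;
    truncation keeps the integral, as the open segment between \<open>a\<close> and \<open>u\<close>
    lies there.\<close>
  define h' where "h' t = indicat_real {0<..X} t *\<^sub>R h t" for t
  have h'[measurable]: "h' \<in> borel_measurable borel"
    using assms(1) by (simp add: set_borel_measurable_def h'_def[abs_def])
  have [measurable]: "(\<lambda>(u, t). segment_sign a u t) \<in> borel_measurable (borel \<Otimes>\<^sub>M borel)"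
  proof -
    have "(\<lambda>(u, t). segment_sign a u t) =
      (\<lambda>p. (if a < snd p \<and> snd p < fst p then 1 else 0) - (if fst p < snd p \<and> snd p < a then 1 else 0))"
      by (auto simp: segment_sign_def indicator_def fun_eq_iff)
    then show ?thesis by simp
  qed
  have *: "(\<lambda>u. \<integral>t. segment_sign a u t *\<^sub>R h' t \<partial>lborel) \<in> borel_measurable borel"
    by (rule lborel.borel_measurable_lebesgue_integral) simp
  have eq: "indicat_real {0<..X} u *\<^sub>R interval_mean a h u =
    indicat_real {0<..X} u *\<^sub>R (1 / of_real (u - a) * (\<integral>t. segment_sign a u t *\<^sub>R h' t \<partial>lborel))" for u
    unfolding interval_mean_altdef using assms
    by (cases "u \<in> {0<..X}")
       (auto simp: h'_def segment_sign_def indicator_def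
         intro!: arg_cong2[of _ _ _ _ "(*)"] arg_cong2[of _ _ _ _ "(/)"] Bochner_Integration.integral_cong)
  show ?thesis
    unfolding set_borel_measurable_def eq using * by simp
qed

text \<open>The weight \<open>N z\<close> preserves the uniform bound. A weight proportional to
  \<open>1 / sqrt t\<close> preserves the singular one with \<open>K\<close> doubled, and supplies
  the majorant for holomorphy.\<close>

lemma admissible_interval_mean:
  assumes G: "admissible N X G" and N: "continuous_on UNIV N" "\<And>z. 0 \<le> N z"
    and a: "0 \<le> a" "a \<le> X"
  shows "admissible N X (\<lambda>z. interval_mean a (G z))"
proof -
  let ?S = "{z. Re z > -1/2}"
  have meas: "\<And>z. z \<in> ?S \<Longrightarrow> set_borel_measurable borel {0<..X} (G z)"
    and holo: "\<And>u. u \<in> {0<..X} \<Longrightarrow> (\<lambda>z. G z u) holomorphic_on ?S"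
    and bound: "\<And>z u. Re z \<ge> 0 \<Longrightarrow> u \<in> {0<..X} \<Longrightarrow> norm (G z u) \<le> N z"
    using G by (auto simp: admissible_def)
  obtain K where "K \<ge> 0"
    and K: "\<And>z u. z \<in> ?S \<Longrightarrow> u \<in> {0<..X} \<Longrightarrow> norm (G z u) \<le> K * N z / sqrt u"
    using G by (auto simp: admissible_def)
  have "open ?S"
    by (simp add: open_halfspace_Re_gt)
  have "norm (interval_mean a (G z) u) \<le> 2 * K * N z / sqrt u"
    if z: "z \<in> ?S" and u: "u \<in> {0<..X}" for z u
  proof (rule norm_interval_mean_le)
    let ?I = "{min a u<..<max a u}"
    have sq: "set_integrable lborel ?I (\<lambda>t. 1 / sqrt t)"
      "(LBINT t:?I. 1 / sqrt t) = 2 * (sqrt (max a u) - sqrt (min a u))"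
      by (rule set_integral_inverse_sqrt; use a u in auto)+
    show "set_integrable lborel ?I (\<lambda>t. K * N z * (1 / sqrt t))"
      using sq(1) by (rule set_integrable_mult_right)
    show "norm (G z t) \<le> K * N z * (1 / sqrt t)" if "min a u < t" "t < max a u" for t
      using K[OF z, of t] that a u by (auto simp: min_def max_def split: if_splits)
    have "2 * (sqrt (max a u) - sqrt (min a u)) = 2 * \<bar>sqrt u - sqrt a\<bar>"
      by (auto simp: min_def max_def abs_if)
    \<comment> \<open>Factor \<open>u - a\<close> as a difference of squares and drop
      \<open>sqrt a\<close> from \<open>sqrt u + sqrt a\<close>.\<close>
    also have "\<dots> \<le> 2 / sqrt u * \<bar>u - a\<bar>"
    proof -
      have "\<bar>u - a\<bar> = \<bar>sqrt u - sqrt a\<bar> * (sqrt u + sqrt a)"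
      proof -
        have "u - a = (sqrt u - sqrt a) * (sqrt u + sqrt a)"
          using a u by (simp add: algebra_simps)
        moreover have "\<bar>sqrt u + sqrt a\<bar> = sqrt u + sqrt a"
          using a u by simp
        ultimately show ?thesis by (metis abs_mult)
      qed
      moreover have "\<bar>sqrt u - sqrt a\<bar> * sqrt u \<le> \<bar>sqrt u - sqrt a\<bar> * (sqrt u + sqrt a)"
        by (rule mult_left_mono) (use a in auto)
      ultimately show ?thesis
        using u by (simp add: field_simps)
    qed
    finally have "K * N z * (2 * (sqrt (max a u) - sqrt (min a u))) \<le> K * N z * (2 / sqrt u * \<bar>u - a\<bar>)"
      by (rule mult_left_mono) (use \<open>K \<ge> 0\<close> N in auto)
    moreover have "(LBINT t:?I. K * N z * (1 / sqrt t)) = K * N z * (LBINT t:?I. 1 / sqrt t)"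
      by (rule set_integral_mult_right)
    ultimately show "(LBINT t:?I. K * N z * (1 / sqrt t)) \<le> 2 * K * N z / sqrt u * \<bar>u - a\<bar>"
      using sq(2) by (simp add: mult_ac)
    show "0 \<le> 2 * K * N z / sqrt u"
      using \<open>K \<ge> 0\<close> N u by auto
  qed
  moreover have "norm (interval_mean a (G z) u) \<le> N z" if "Re z \<ge> 0" "u \<in> {0<..X}" for z u
  proof (rule norm_interval_mean_le)
    show "norm (G z t) \<le> N z" if "min a u < t" "t < max a u" for t
      using bound[OF \<open>Re z \<ge> 0\<close>, of t] that a \<open>u \<in> {0<..X}\<close>
      by (auto simp: min_def max_def split: if_splits)
    show "set_integrable lborel {min a u<..<max a u} (\<lambda>_. N z)"
      by (auto simp: set_integrable_def)
    show "(LBINT t:{min a u<..<max a u}. N z) \<le> N z * \<bar>u - a\<bar>"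
      by (simp add: set_lebesgue_integral_def min_def max_def mult.commute)
  qed (use N in auto)
  moreover have "set_borel_measurable borel {0<..X} (interval_mean a (G z))" if "z \<in> ?S" for z
    using set_borel_measurable_interval_mean[OF meas[OF that] a] .
  moreover have "(\<lambda>z. interval_mean a (G z) u) holomorphic_on ?S" if u: "u \<in> {0<..X}" for u
  proof -
    let ?I = "{min a u<..<max a u}"
    let ?f = "\<lambda>z t. segment_sign a u t *\<^sub>R G z t"
    have I_sub: "?I \<subseteq> {0<..X}"
      using a u by auto
    have "(\<lambda>z. \<integral>t. ?f z t \<partial>lborel) holomorphic_on ?S"
    proof (rule holomorphic_on_lebesgue_integral[OF \<open>open ?S\<close>])
      fix z assume z: "z \<in> ?S"
      have eq: "?f z = (\<lambda>t. segment_sign a u t *\<^sub>R (indicat_real {0<..X} t *\<^sub>R G z t))"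
      proof
        show "?f z t = segment_sign a u t *\<^sub>R (indicat_real {0<..X} t *\<^sub>R G z t)" for t
          using a u by (auto simp: segment_sign_def indicator_def)
      qed
      have "segment_sign a u \<in> borel_measurable lborel"
        unfolding segment_sign_def[abs_def] by simp
      moreover have "(\<lambda>t. indicat_real {0<..X} t *\<^sub>R G z t) \<in> borel_measurable lborel"
        using meas[OF z] by (simp add: set_borel_measurable_def)
      ultimately show "?f z \<in> borel_measurable lborel"
        unfolding eq by (rule borel_measurable_scaleR)
      obtain r where "r > 0" and r: "cball z r \<subseteq> ?S"
        using \<open>open ?S\<close> z open_contains_cball by blast
      \<comment> \<open>The continuous \<open>N\<close> is bounded on a closed disc, so one majorant
        serves all \<open>y\<close> near \<open>z\<close>.\<close>
      have "compact (N ` cball z r)"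
        by (intro compact_continuous_image continuous_on_subset[OF N(1)]) auto
      then obtain R where R: "\<And>y. y \<in> cball z r \<Longrightarrow> N y \<le> R"
        by (metis bdd_above.unfold bounded_imp_bdd_above compact_imp_bounded imageI)
      show "\<exists>r>0. \<exists>w. integrable lborel w \<and> (\<forall>y\<in>ball z r. \<forall>x\<in>space lborel. norm (?f y x) \<le> w x)"
      proof (intro exI conjI ballI)
        show "r > 0" by fact
        have "set_integrable lborel ?I (\<lambda>t. 1 / sqrt t)"
          by (rule set_integral_inverse_sqrt; use a u in auto)+
        then show "integrable lborel (\<lambda>t. K * R * (indicat_real ?I t * (1 / sqrt t)))"
          unfolding set_integrable_def real_scaleR_def by (rule integrable_mult_right)
        show "norm (?f y t) \<le> K * R * (indicat_real ?I t * (1 / sqrt t))" if "y \<in> ball z r" for y t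
        proof (cases "t \<in> ?I")
          case True
          then have "t \<in> {0<..X}" using I_sub by blast
          have "norm (G y t) \<le> K * N y / sqrt t"
            using r that ball_subset_cball by (intro K \<open>t \<in> {0<..X}\<close>) blast
          also have "\<dots> \<le> K * R / sqrt t"
            using R[of y] that \<open>K \<ge> 0\<close> \<open>t \<in> {0<..X}\<close> by (auto intro!: divide_right_mono mult_left_mono)
          finally show ?thesis using True by (simp add: abs_segment_sign)
        qed (simp add: abs_segment_sign)
      qed
    next
      fix t
      show "(\<lambda>z. ?f z t) holomorphic_on ?S"
      proof (cases "t \<in> ?I")
        case True
        then have "t \<in> {0<..X}" using I_sub by blast
        then show ?thesis
          unfolding scaleR_conv_of_real by (intro holomorphic_intros holo)
      next
        case False
        then have "segment_sign a u t = 0" using abs_segment_sign[of a u t] by simp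
        then show ?thesis by simp
      qed
    qed
    then show ?thesis
      unfolding interval_mean_altdef by (intro holomorphic_intros)
  qed
  ultimately show ?thesis
    unfolding admissible_def using \<open>K \<ge> 0\<close>
    by (intro conjI allI ballI impI exI[of _ "2 * K"]) auto
qed

section \<open>The innermost kernel\<close>

text \<open>The 4 bounds the kernel for \<open>u < 1/2\<close> and \<open>Re z \<ge> 0\<close>; the
  other term bounds it for \<open>u\<close> between 1/2 and \<open>X\<close>. On the imaginary axis
  the exponential is 1.\<close>

definition growth :: "real \<Rightarrow> complex \<Rightarrow> real" where
  "growth X z = 4 + 2 * norm z * exp (\<bar>Re z\<bar> * ln X)"

text \<open>Split at \<open>u = 1/2\<close>. Below, the denominator has modulus at least 1/2; above,
  the numerator \<open>exp (z * ln u) - 1\<close> is small enough near \<open>u = 1\<close> to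
  cancel the denominator.\<close>

lemma admissible_kernel:
  assumes "X \<ge> 2"
  shows "admissible (growth X) X (\<lambda>z u. (of_real u powr z - 1) / of_real (u - 1))"
proof -
  let ?S = "{z. Re z > -1/2}" and ?k = "\<lambda>z u. (complex_of_real u powr z - 1) / of_real (u - 1)"
  have growth_ge: "4 \<le> growth X z" for z
    by (simp add: growth_def)
  have away: "norm (?k z u) \<le> growth X z" if u: "1/2 \<le> u" "u \<le> X" for z u
  proof (cases "u = 1")
    case False
    have lnX: "\<bar>ln u\<bar> \<le> ln X"
    proof -
      have "ln u \<le> ln X" using u by simp
      moreover have "ln (1 / u) \<le> ln X"
      proof (rule ln_mono)
        have "1 / u \<le> 2" using u by (simp add: field_simps)
        then show "1 / u \<le> X" using \<open>X \<ge> 2\<close> by linarith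
      qed (use u in auto)
      moreover have "ln (1 / u) = - ln u" using u by (simp add: ln_div)
      ultimately show ?thesis by linarith
    qed
    \<comment> \<open>The factor 2 comes from \<open>1 / u \<le> 2\<close>; this bound is what
      cancels \<open>u - 1\<close>.\<close>
    have ln_le: "\<bar>ln u\<bar> \<le> 2 * \<bar>u - 1\<bar>"
    proof (cases "u \<ge> 1")
      case True
      then show ?thesis using ln_le_minus_one[of u] by auto
    next
      case False
      have "- ln u \<le> 1 / u - 1"
        using ln_le_minus_one[of "1 / u"] u by (simp add: ln_div)
      also have "1 / u - 1 = (1 - u) / u" using u by (simp add: field_simps)
      also have "\<dots> \<le> (1 - u) / (1 / 2)"
        using u False by (intro divide_left_mono) auto
      finally show ?thesis using False u by simp
    qed
    define v where "v = z * of_real (ln u)"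
    have "norm (of_real u powr z - 1) = norm (exp v - 1)"
      using u by (simp add: powr_def v_def Ln_of_real)
    also have "\<dots> \<le> exp \<bar>Re v\<bar> * norm v"
      using Taylor_exp[of v 0] by simp
    also have "\<dots> \<le> exp (\<bar>Re z\<bar> * ln X) * (norm z * (2 * \<bar>u - 1\<bar>))"
    proof (rule mult_mono)
      show "exp \<bar>Re v\<bar> \<le> exp (\<bar>Re z\<bar> * ln X)"
        using lnX by (simp add: v_def abs_mult mult_left_mono)
      show "norm v \<le> norm z * (2 * \<bar>u - 1\<bar>)"
        using ln_le by (simp add: v_def norm_mult mult_left_mono)
    qed auto
    finally have "norm (of_real u powr z - 1) \<le> 2 * norm z * exp (\<bar>Re z\<bar> * ln X) * \<bar>u - 1\<bar>"
      by (simp add: mult_ac)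
    then have "norm (?k z u) \<le> 2 * norm z * exp (\<bar>Re z\<bar> * ln X)"
      using False by (simp add: norm_divide field_simps flip: of_real_diff)
    then show ?thesis by (simp add: growth_def)
  qed (simp add: growth_def)
  have near: "norm (?k z u) \<le> 2 * (u powr Re z + 1)" if "0 < u" "u < 1/2" for z u
  proof -
    have "norm (?k z u) = norm (of_real u powr z - 1) / \<bar>u - 1\<bar>"
      by (simp add: norm_divide flip: of_real_diff)
    also have "\<dots> \<le> (u powr Re z + 1) / (1 / 2)"
    proof (rule frac_le)
      show "norm (of_real u powr z - 1) \<le> u powr Re z + 1"
        using norm_triangle_ineq4[of "of_real u powr z" 1] that
        by (simp add: norm_powr_real_powr)
    qed (use that in auto)
    finally show ?thesis by simp
  qed
  have unif: "norm (?k z u) \<le> growth X z" if "Re z \<ge> 0" "u \<in> {0<..X}" for z u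
  proof (cases "u < 1/2")
    case True
    have "u powr Re z \<le> 1"
      using that True by (intro powr_le1) auto
    then show ?thesis
      using near[of u z] True that growth_ge[of z] by auto
  qed (use away that in auto)
  \<comment> \<open>\<open>sqrt X\<close> serves as \<open>K\<close> in both ranges, since
    \<open>sqrt X\<close> and \<open>sqrt X / sqrt u\<close> are at least 1. Near 0,
    \<open>Re z > -1/2\<close> bounds \<open>u powr Re z\<close> by
    \<open>1 / sqrt u\<close>.\<close>
  have weak: "norm (?k z u) \<le> sqrt X * growth X z / sqrt u"
    if z: "z \<in> ?S" and u: "u \<in> {0<..X}" for z u
  proof (cases "u < 1/2")
    case True
    have "u powr Re z \<le> u powr (-1/2)"
      using u True z by (intro powr_mono') auto
    also have "\<dots> = 1 / sqrt u"
      using u powr_minus_divide[of u "1/2"] by (simp add: powr_half_sqrt)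
    finally have "norm (?k z u) \<le> 2 * (1 / sqrt u + 1)"
      using near[of u z] u True by auto
    also have "\<dots> \<le> 1 * 4 / sqrt u"
      using u True by (simp add: field_simps)
    also have "\<dots> \<le> sqrt X * growth X z / sqrt u"
      using growth_ge[of z] u \<open>X \<ge> 2\<close> by (intro divide_right_mono mult_mono) auto
    finally show ?thesis .
  next
    case False
    have "norm (?k z u) \<le> growth X z * 1"
      using away[of u z] False u by simp
    also have "\<dots> \<le> growth X z * (sqrt X / sqrt u)"
      using growth_ge[of z] u by (intro mult_left_mono) auto
    finally show ?thesis by (simp add: mult_ac)
  qed
  have meas: "set_borel_measurable borel {0<..X} (?k z)" for z
  proof -
    have eq: "indicat_real {0<..X} u *\<^sub>R ?k z u =
      indicat_real {0<..X} u *\<^sub>R ((exp (z * of_real (ln u)) - 1) / of_real (u - 1))" for u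
      by (auto simp: indicator_def powr_def Ln_of_real)
    show ?thesis
      unfolding set_borel_measurable_def eq by measurable
  qed
  have holo: "(\<lambda>z. ?k z u) holomorphic_on ?S" if "u \<in> {0<..X}" for u
  proof -
    \<comment> \<open>The inverse is a constant in \<open>z\<close>, so holomorphy also covers
      \<open>u = 1\<close>, where it is 0.\<close>
    have eq: "?k z u = (exp (z * of_real (ln u)) - 1) * inverse (of_real (u - 1))" for z
      using that by (simp add: powr_def Ln_of_real divide_inverse)
    show ?thesis
      unfolding eq by (intro holomorphic_intros)
  qed
  show ?thesis
    unfolding admissible_def
  proof (intro conjI allI ballI impI exI[of _ "sqrt X"])
    show "0 \<le> sqrt X" using \<open>X \<ge> 2\<close> by simp
  qed (use unif weak meas holo in blast)+
qed

lemma continuous_on_growth: "continuous_on UNIV (growth X)"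
  unfolding growth_def[abs_def] by (intro continuous_intros)

lemma growth_nonneg: "0 \<le> growth X z"
  by (simp add: growth_def)

section \<open>The nested integral as an iterated mean\<close>

lemma average_eq_interval_mean: "average = interval_mean 0"
  by (simp add: average_def interval_mean_def fun_eq_iff zero_ereal_def)

lemma admissible_average_funpow:
  assumes "admissible N X G" "continuous_on UNIV N" "\<And>z. 0 \<le> N z" "0 \<le> X"
  shows "admissible N X (\<lambda>z. (average ^^ n) (G z))"
proof (induction n)
  case (Suc n)
  then show ?case
    using admissible_interval_mean[OF Suc assms(2,3), of 0] assms(4)
    by (simp add: average_eq_interval_mean)
qed (use assms in simp)

text \<open>Each level only takes further means, so the same \<open>growth X\<close> serves
  throughout. The base is the kernel, as \<open>bprod b 0 = 1\<close>; \<open>n\<close> is general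
  because level \<open>Suc j\<close> uses level \<open>j\<close> at
  \<open>m (Suc j)\<close>.\<close>

lemma admissible_nested_g:
  assumes "X \<ge> 2" and "\<And>i. i \<le> j \<Longrightarrow> 0 \<le> bprod b i \<and> bprod b i \<le> X"
  shows "admissible (growth X) X (\<lambda>z. nested_g (nested_F m b z j) (bprod b j) n)"
  using assms(2)
proof (induction j arbitrary: n)
  case 0
  show ?case
    unfolding nested_g_def
    by (rule admissible_average_funpow)
       (use admissible_kernel[OF \<open>X \<ge> 2\<close>] \<open>X \<ge> 2\<close> in
         \<open>simp_all add: bprod_def continuous_on_growth growth_nonneg\<close>)
next
  case (Suc j)
  \<comment> \<open>\<open>nested_F\<close> integrates from the very point that the next denominator
    subtracts, so the quotient is exactly a mean.\<close>
  have quotient: "(\<lambda>u. nested_F m b z (Suc j) u / of_real (u - bprod b (Suc j))) =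
    interval_mean (bprod b (Suc j)) (nested_g (nested_F m b z j) (bprod b j) (m (Suc j)))" for z
    by (simp add: interval_mean_def fun_eq_iff)
  show ?case
    unfolding nested_g_def[of "nested_F m b _ (Suc j)"] quotient
    by (intro admissible_average_funpow admissible_interval_mean Suc.IH)
       (use Suc.prems \<open>X \<ge> 2\<close> in \<open>simp_all add: continuous_on_growth growth_nonneg\<close>)
qed

theorem proposition6p3:
  fixes k :: nat and m :: "nat \<Rightarrow> nat" and b :: "nat \<Rightarrow> real"
  assumes "k \<ge> 1"
    and "\<And>j. j \<in> {1..k} \<Longrightarrow> m j \<ge> 1"
    and "\<And>j. j \<in> {1..k} \<Longrightarrow> b j > 0"
  shows "carlson_type (\<lambda>z. nested_integral k m b z)"
proof -
  define B where "B = bprod b k"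
  \<comment> \<open>Large enough for the kernel, which needs 2, and for every base point
    \<open>bprod b j\<close>.\<close>
  define X where "X = 2 + (\<Sum>j\<le>k. bprod b j)"
  have pos: "bprod b j > 0" if "j \<le> k" for j
    unfolding bprod_def using that assms(3) by (intro prod_pos) auto
  have "(\<Sum>j\<le>k. bprod b j) \<ge> 0"
    using pos by (intro sum_nonneg) (auto intro: less_imp_le)
  then have "X \<ge> 2" by (simp add: X_def)
  have le_X: "bprod b j \<le> X" if "j \<le> k" for j
    using member_le_sum[of j "{..k}" "bprod b"] that pos by (force simp: X_def less_imp_le)
  have B: "B > 0" "B \<le> X"
    using pos le_X by (auto simp: B_def)
  let ?f = "\<lambda>z. nested_integral k m b z"
  \<comment> \<open>The outermost integral is \<open>B\<close> times one more mean with base point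
    0.\<close>
  define G where "G z = interval_mean 0 (nested_g (nested_F m b z (k - 1)) (bprod b (k - 1)) (m k)) B" for z
  have f_eq: "?f z = of_real B * G z" for z
    using B by (simp add: nested_integral_def G_def interval_mean_def zero_ereal_def B_def)
  have "admissible (growth X) X
    (\<lambda>z. interval_mean 0 (nested_g (nested_F m b z (k - 1)) (bprod b (k - 1)) (m k)))"
    by (intro admissible_interval_mean admissible_nested_g)
       (use \<open>X \<ge> 2\<close> pos le_X in \<open>auto simp: continuous_on_growth growth_nonneg less_imp_le\<close>)
  then have holo: "G holomorphic_on {z. Re z > -1/2}"
    and bound: "\<And>z. Re z \<ge> 0 \<Longrightarrow> norm (G z) \<le> growth X z"
    using B by (auto simp: admissible_def G_def[abs_def])
  \<comment> \<open>Keeping \<open>norm z\<close> and \<open>\<bar>Re z\<bar>\<close> apart makes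
    the \<open>ln X\<close> term vanish on the imaginary axis, leaving type \<open>1 < pi\<close>
    for every \<open>X\<close>.\<close>
  have f_le: "norm (?f z) \<le> 4 * B * exp (norm z + \<bar>Re z\<bar> * ln X)" if "Re z \<ge> 0" for z
  proof -
    have "growth X z \<le> 4 * (1 + norm z) * exp (\<bar>Re z\<bar> * ln X)"
    proof -
      define E where "E = exp (\<bar>Re z\<bar> * ln X)"
      have "1 \<le> E" using \<open>X \<ge> 2\<close> by (simp add: E_def)
      moreover have "0 \<le> norm z * E" by (simp add: E_def)
      moreover have "4 * (1 + norm z) * E = 4 * E + 4 * (norm z * E)"
        by (simp add: algebra_simps)
      ultimately show ?thesis
        unfolding growth_def E_def[symmetric] mult.assoc[of 2] by linarith
    qed
    also have "\<dots> \<le> 4 * exp (norm z) * exp (\<bar>Re z\<bar> * ln X)"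
      by (intro mult_right_mono mult_left_mono exp_ge_add_one_self) auto
    finally have "norm (G z) \<le> 4 * exp (norm z + \<bar>Re z\<bar> * ln X)"
      using bound[OF that] by (simp add: exp_add)
    then show ?thesis
      using B by (simp add: f_eq norm_mult)
  qed
  \<comment> \<open>The larger open half plane supplies the neighbourhoods required at boundary
    points.\<close>
  have "?f analytic_on {z. Re z \<ge> 0}"
  proof (rule analytic_on_subset)
    show "?f analytic_on {z. Re z > -1/2}"
      unfolding f_eq analytic_on_open[OF open_halfspace_Re_gt]
      by (intro holomorphic_intros holo)
  qed auto
  moreover have "\<forall>z. Re z \<ge> 0 \<longrightarrow> norm (?f z) \<le> 4 * B * exp ((1 + ln X) * norm z)"
  proof (intro allI impI)
    fix z :: complex assume z: "Re z \<ge> 0"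
    have "\<bar>Re z\<bar> * ln X \<le> norm z * ln X"
      using \<open>X \<ge> 2\<close> abs_Re_le_cmod by (intro mult_right_mono) auto
    then have "4 * B * exp (norm z + \<bar>Re z\<bar> * ln X) \<le> 4 * B * exp ((1 + ln X) * norm z)"
      using B by (simp add: algebra_simps)
    then show "norm (?f z) \<le> 4 * B * exp ((1 + ln X) * norm z)"
      using f_le[OF z] by linarith
  qed
  moreover have "\<forall>y. norm (?f (\<i> * of_real y)) \<le> 4 * B * exp (1 * \<bar>y\<bar>)"
  proof
    show "norm (?f (\<i> * of_real y)) \<le> 4 * B * exp (1 * \<bar>y\<bar>)" for y
      using f_le[of "\<i> * of_real y"] by (simp add: norm_mult)
  qed
  moreover have "1 + ln X > 0"
    using \<open>X \<ge> 2\<close> by (simp add: add_pos_nonneg)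
  moreover have "(1::real) < pi" using pi_gt3 by linarith
  moreover have "4 * B > 0" using B by simp
  ultimately show ?thesis
    unfolding carlson_type_def using zero_less_one by blast
qed

end
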